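(* Let $(X,b,m)$ be a connected weighted graph and let $\Omega\subsetneq X$ be a proper subset such that the inradius satisfies $R_\Omega<\infty$ and such that $\mathrm{vol}^\sharp[R_\Omega]<\infty$. Then $$\lambda_0^D(\Omega)\ \ge\ \frac{1}{R_\Omega\cdot\mathrm{vol}^\sharp[R_\Omega]} .$$
   Context: A weighted graph is a triple $(X,b,m)$ where $X$ is an arbitrary set (of vertices), $b:X\times X\to[0,\infty)$ is symmetric with $b(x,x)=0$ for all $x\in X$, and $m:X\to(0,\infty)$ is a function. No local finiteness or summability of $b$ is assumed. For $A\subset X$ put $m(A)=\mathrm{vol}(A)=\sum_{x\in A}m(x)\in[0,\infty]$. A path from $x$ to $y$ is a finite sequence $\gamma=(x_0,\dots,x_k)$ in $X$ with $x_0=x$, $x_k=y$ and $b(x_l,x_{l+1})>0$ for $l=0,\dots,k-1$; its length is $L(\gamma)=\sum_{j=0}^{k-1}\frac{1}{b(x_j,x_{j+1})}$. The graph is connected if any two vertices are joined by a path. The pseudo-metric $d$ is $d(x,y)=\inf\{L(\gamma)\mid\gamma\text{ a path from }x\text{ to }y\}$ with $d(x,x)=0$ (it need not separate points). Open balls are $U_r(x)=\{y\in X\mid d(x,y)<r\}$. The inradius of $\Omega\subset X$ is $$R_\Omega=\sup\{r>0\mid \text{there exists }x\in\Omega\text{ with }U_r(x)\subset\Omega\},$$ with the supremum of the empty set taken to be $0$. For $r\ge0$, $$\mathrm{vol}^\sharp[r]=\inf_{s>r}\ \sup\{m(U_s(x))\mid x\in X\}.$$ The energy is $\mathcal{E}(f)=\frac12\sum_{x,y\in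 X}b(x,y)(f(x)-f(y))^2\in[0,\infty]$ for $f:X\to\mathbb{R}$. The Hilbert space $\ell^2(X,m)$ consists of $f:X\to\mathbb{R}$ with $\sum_{x}f(x)^2m(x)<\infty$, with norm $\|f\|=\left(\sum_x f(x)^2m(x)\right)^{1/2}$. For $\Omega\subset X$, $$\lambda_0^D(\Omega)=\inf\{\mathcal{E}(f)\mid f\in\ell^2(X,m),\ \mathcal{E}(f)<\infty,\ f=0\text{ on }X\setminus\Omega,\ \|f\|=1\},$$ with $\inf\emptyset=\infty$. The convention $1/0=\infty$ is used. *)

theory Defs
  imports "HOL-Analysis.Analysis"
begin

text \<open>
  The vertex set is an explicit carrier \<open>X\<close>; all functions on vertices are total on the ambient
  type and every notion below only looks at their values on \<open>X\<close>. Quantities in \<open>[0,\<infinity>]\<close> live in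
  \<^typ>\<open>ennreal\<close>, where the empty supremum is \<open>0\<close>, the empty infimum is \<open>\<infinity>\<close>, and \<open>1 / 0 = \<infinity>\<close>.
\<close>

locale weighted_graph =
  fixes X :: "'a set" and b :: "'a \<Rightarrow> 'a \<Rightarrow> real" and m :: "'a \<Rightarrow> real"
  assumes weight_nonneg: "\<lbrakk>x \<in> X; y \<in> X\<rbrakk> \<Longrightarrow> 0 \<le> b x y"
    and weight_sym: "\<lbrakk>x \<in> X; y \<in> X\<rbrakk> \<Longrightarrow> b x y = b y x"
    and weight_diag: "x \<in> X \<Longrightarrow> b x x = 0"
    and measure_pos: "x \<in> X \<Longrightarrow> 0 < m x"

definition vol :: "('a \<Rightarrow> real) \<Rightarrow> 'a set \<Rightarrow> ennreal" where
  "vol m A = (\<Sum>\<^sub>\<infinity>x\<in>A. ennreal (m x))"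

text \<open>A path \<open>(x\<^sub>0, \<dots>, x\<^sub>k)\<close> is a list of length \<open>k + 1\<close>; \<open>k = 0\<close> is allowed.\<close>

definition graph_path :: "'a set \<Rightarrow> ('a \<Rightarrow> 'a \<Rightarrow> real) \<Rightarrow> 'a \<Rightarrow> 'a \<Rightarrow> 'a list \<Rightarrow> bool" where
  "graph_path X b x y p \<longleftrightarrow>
     p \<noteq> [] \<and> set p \<subseteq> X \<and> hd p = x \<and> last p = y \<and>
     (\<forall>l. l + 1 < length p \<longrightarrow> 0 < b (p ! l) (p ! (l + 1)))"

definition graph_path_length :: "('a \<Rightarrow> 'a \<Rightarrow> real) \<Rightarrow> 'a list \<Rightarrow> real" where
  "graph_path_length b p = (\<Sum>j<length p - 1. 1 / b (p ! j) (p ! (j + 1)))"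

definition connected_graph :: "'a set \<Rightarrow> ('a \<Rightarrow> 'a \<Rightarrow> real) \<Rightarrow> bool" where
  "connected_graph X b \<longleftrightarrow> (\<forall>x\<in>X. \<forall>y\<in>X. \<exists>p. graph_path X b x y p)"

definition path_dist :: "'a set \<Rightarrow> ('a \<Rightarrow> 'a \<Rightarrow> real) \<Rightarrow> 'a \<Rightarrow> 'a \<Rightarrow> ennreal" where
  "path_dist X b x y = (INF p\<in>{p. graph_path X b x y p}. ennreal (graph_path_length b p))"

text \<open>The one-vertex path gives the convention that the distance of a vertex to itself is zero.\<close>

lemma path_dist_self: "x \<in> X \<Longrightarrow> path_dist X b x x = 0"
proof -
  assume "x \<in> X"
  then have "[x] \<in> {p. graph_path X b x x p}"
    by (simp add: graph_path_def)
  then have "path_dist X b x x \<le> ennreal (graph_path_length b [x])"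
    unfolding path_dist_def by (rule INF_lower)
  then show ?thesis
    by (simp add: graph_path_length_def)
qed

definition path_ball :: "'a set \<Rightarrow> ('a \<Rightarrow> 'a \<Rightarrow> real) \<Rightarrow> real \<Rightarrow> 'a \<Rightarrow> 'a set" where
  "path_ball X b r x = {y\<in>X. path_dist X b x y < ennreal r}"

definition inradius :: "'a set \<Rightarrow> ('a \<Rightarrow> 'a \<Rightarrow> real) \<Rightarrow> 'a set \<Rightarrow> ennreal" where
  "inradius X b \<Omega> = (SUP r\<in>{r::real. 0 < r \<and> (\<exists>x\<in>\<Omega>. path_ball X b r x \<subseteq> \<Omega>)}. ennreal r)"

definition vol_sharp ::
  "'a set \<Rightarrow> ('a \<Rightarrow> 'a \<Rightarrow> real) \<Rightarrow> ('a \<Rightarrow> real) \<Rightarrow> ennreal \<Rightarrow> ennreal" where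
  "vol_sharp X b m r = (INF s\<in>{s::real. r < ennreal s}. SUP x\<in>X. vol m (path_ball X b s x))"

definition energy :: "'a set \<Rightarrow> ('a \<Rightarrow> 'a \<Rightarrow> real) \<Rightarrow> ('a \<Rightarrow> real) \<Rightarrow> ennreal" where
  "energy X b f = 1 / 2 * (\<Sum>\<^sub>\<infinity>(x, y)\<in>X \<times> X. ennreal (b x y * (f x - f y)\<^sup>2))"

definition ell2 :: "'a set \<Rightarrow> ('a \<Rightarrow> real) \<Rightarrow> ('a \<Rightarrow> real) set" where
  "ell2 X m = {f. (\<lambda>x. (f x)\<^sup>2 * m x) summable_on X}"

definition ell2_norm :: "'a set \<Rightarrow> ('a \<Rightarrow> real) \<Rightarrow> ('a \<Rightarrow> real) \<Rightarrow> real" where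
  "ell2_norm X m f = sqrt (\<Sum>\<^sub>\<infinity>x\<in>X. (f x)\<^sup>2 * m x)"

definition dirichlet_bottom ::
  "'a set \<Rightarrow> ('a \<Rightarrow> 'a \<Rightarrow> real) \<Rightarrow> ('a \<Rightarrow> real) \<Rightarrow> 'a set \<Rightarrow> ennreal" where
  "dirichlet_bottom X b m \<Omega> =
     (INF f\<in>{f \<in> ell2 X m. energy X b f < \<infinity> \<and> (\<forall>x\<in>X - \<Omega>. f x = 0) \<and> ell2_norm X m f = 1}.
        energy X b f)"

end

theory Submission
  imports Defs
begin

text \<open>
  If \<open>s\<close> exceeds the inradius \<open>R\<close>, no ball of radius \<open>s\<close> centred in \<open>\<Omega>\<close> stays inside \<open>\<Omega>\<close>, so every
  \<open>x \<in> \<Omega>\<close> has a path \<open>\<gamma>\<^sub>x\<close> of length less than \<open>s\<close> to a vertex outside \<open>\<Omega>\<close>, where a test function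
  \<open>f\<close> vanishes. Deleting loops makes \<open>\<gamma>\<^sub>x\<close> use each undirected edge at most once
  (\<open>graph_path_loop_removal\<close>), and telescoping with Cauchy--Schwarz bounds \<open>f(x)\<^sup>2\<close> by \<open>s\<close> times the
  energy of \<open>f\<close> on the edges of \<open>\<gamma>\<^sub>x\<close> (\<open>square_diff_le_sum_path_arcs\<close>).

  Now multiply by \<open>m(x)\<close>, sum over \<open>x\<close> and exchange the two sums. The energy of \<open>f\<close> on an edge from
  \<open>u\<close> to \<open>v\<close> gets as weight the mass of those \<open>x\<close> whose path uses that edge. Following \<open>\<gamma>\<^sub>x\<close>
  backwards from \<open>u\<close> shows that all these \<open>x\<close> lie in the ball of radius \<open>s\<close> around \<open>u\<close>, so the weight
  is at most the supremum \<open>V\<close> of the volumes of such balls. This gives the Poincare inequality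
  \<open>\<parallel>f\<parallel>\<^sup>2 \<le> s V \<E>(f)\<close> (\<open>poincare_finite\<close>). Letting \<open>s\<close> decrease to \<open>R\<close>, which lets \<open>V\<close> approach
  \<open>vol\<^sup>\<sharp>[R]\<close>, proves \<open>1 \<le> R vol\<^sup>\<sharp>[R] \<E>(f)\<close> for every normalised test function
  (\<open>energy_lower_bound\<close>).

  The vertex set may be uncountable. The exchange of sums is nevertheless elementary, since the squared
  norm is a supremum over finite sets of vertices and each path has finitely many edges: only finite
  double sums are ever interchanged.
\<close>

section \<open>Paths as lists\<close>

lemma graph_path_iff_successively:
  "graph_path X b x y p \<longleftrightarrow>
     p \<noteq> [] \<and> set p \<subseteq> X \<and> hd p = x \<and> last p = y \<and> successively (\<lambda>u v. 0 < b u v) p"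
  by (simp add: graph_path_def successively_conv_nth)

lemma graph_path_length_singleton [simp]: "graph_path_length b [x] = 0"
  by (simp add: graph_path_length_def)

lemma graph_path_length_Cons_Cons [simp]:
  "graph_path_length b (x # y # p) = 1 / b x y + graph_path_length b (y # p)"
  by (simp add: graph_path_length_def sum.lessThan_Suc_shift del: sum.lessThan_Suc)

lemma graph_path_length_append:
  "graph_path_length b (p @ a # q) = graph_path_length b (p @ [a]) + graph_path_length b (a # q)"
proof (induction p)
  case (Cons x p)
  then show ?case by (cases p) auto
qed simp

lemma graph_path_length_nonneg:
  assumes "successively (\<lambda>u v. 0 < b u v) p"
  shows "0 \<le> graph_path_length b p"
  unfolding graph_path_length_def
  using assms by (auto intro!: sum_nonneg simp: successively_conv_nth less_imp_le)

text \<open>Cutting out the segment between two visits to the same vertex does not lengthen a path, since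
  edge lengths are positive. Without loops, no edge contributes twice to the sum along the path, which
  is what makes that sum comparable with the energy.\<close>

lemma graph_path_loop_removal:
  assumes "graph_path X b x y p"
  shows "\<exists>q. graph_path X b x y q \<and> distinct q \<and> graph_path_length b q \<le> graph_path_length b p"
  using assms
proof (induction "length p" arbitrary: p rule: less_induct)
  case less
  show ?case
  proof (cases "distinct p")
    case False
    then obtain xs ys zs a where p: "p = xs @ [a] @ ys @ [a] @ zs"
      using not_distinct_decomp by blast
    let ?q = "xs @ a # zs"
    have loop: "successively (\<lambda>u v. 0 < b u v) (a # ys @ [a])"
      using less.prems
      by (auto simp: p graph_path_iff_successively successively_append_iff successively_Cons
          hd_append split: if_splits)
    have "graph_path X b x y ?q"
      using less.prems
      by (auto simp: p graph_path_iff_successively successively_append_iff successively_Cons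
          hd_append split: if_splits)
    then obtain q where q: "graph_path X b x y q" "distinct q"
        "graph_path_length b q \<le> graph_path_length b ?q"
      using less.hyps[of ?q] by (auto simp: p)
    have "graph_path_length b p =
        graph_path_length b ?q + graph_path_length b (a # ys @ [a])"
      using graph_path_length_append[of b xs a "ys @ a # zs"]
        graph_path_length_append[of b "a # ys" a zs] graph_path_length_append[of b xs a zs]
      by (simp add: p)
    then show ?thesis
      using q graph_path_length_nonneg[OF loop] by force
  qed (use less.prems in auto)
qed

context weighted_graph
begin

lemma graph_path_length_rev:
  assumes "set p \<subseteq> X"
  shows "graph_path_length b (rev p) = graph_path_length b p"
  using assms
proof (induction p)
  case (Cons x p)
  then show ?case
    using weight_sym[of x "hd p"]
    by (cases p) (auto simp: graph_path_length_append[of b "rev _" _ "[x]"])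
qed simp

lemma graph_path_rev:
  assumes "graph_path X b x y p"
  shows "graph_path X b y x (rev p)"
proof -
  have "set p \<subseteq> X" and "successively (\<lambda>u v. 0 < b u v) p"
    using assms by (auto simp: graph_path_iff_successively)
  then have "successively (\<lambda>u v. 0 < b v u) p"
    using weight_sym by (elim successively_mono) (auto simp: subset_iff)
  then show ?thesis
    using assms by (auto simp: graph_path_iff_successively hd_rev last_rev)
qed

text \<open>The initial segment of a path up to \<open>u\<close>, read backwards, leads from \<open>u\<close> to the start. Thus the
  starting points of all paths of length less than \<open>s\<close> through \<open>u\<close> are in one ball around \<open>u\<close>.\<close>

lemma path_dist_to_start_le:
  assumes "graph_path X b x y p" and "u \<in> set p"
  shows "path_dist X b u x \<le> ennreal (graph_path_length b p)"
proof -
  obtain q r where p: "p = q @ u # r"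
    using assms(2) split_list by metis
  have "graph_path X b x u (q @ [u])"
    using assms(1)
    by (auto simp: p graph_path_iff_successively successively_append_iff hd_append split: if_splits)
  then have "graph_path X b u x (rev (q @ [u]))"
    by (rule graph_path_rev)
  then have "path_dist X b u x \<le> ennreal (graph_path_length b (rev (q @ [u])))"
    unfolding path_dist_def by (intro INF_lower) simp
  also have "graph_path_length b (rev (q @ [u])) = graph_path_length b (q @ [u])"
    using assms(1) by (intro graph_path_length_rev) (auto simp: p graph_path_def)
  also have "\<dots> \<le> graph_path_length b p"
    using assms(1) graph_path_length_nonneg[of b "u # r"]
    by (auto simp: p graph_path_length_append[of b q u r] graph_path_iff_successively
        successively_append_iff)
  finally show ?thesis by (simp add: ennreal_leI)
qed

section \<open>The gradient along a path\<close>

text \<open>Each edge of the path occurs in both orientations, to match the energy, which is a sum over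
  ordered pairs.\<close>

definition path_arcs :: "'a list \<Rightarrow> ('a \<times> 'a) set" where
  "path_arcs p = (\<lambda>j. (p ! j, p ! Suc j)) ` {..<length p - 1} \<union>
     (\<lambda>j. (p ! Suc j, p ! j)) ` {..<length p - 1}"

lemma finite_path_arcs [simp]: "finite (path_arcs p)"
  by (simp add: path_arcs_def)

lemma path_arcs_subset: "path_arcs p \<subseteq> set p \<times> set p"
  by (auto simp: path_arcs_def)

lemma sum_path_arcs:
  fixes g :: "'a \<times> 'a \<Rightarrow> real"
  assumes "distinct p" and "\<And>u v. u \<in> set p \<Longrightarrow> v \<in> set p \<Longrightarrow> g (u, v) = g (v, u)"
  shows "sum g (path_arcs p) = 2 * (\<Sum>j<length p - 1. g (p ! j, p ! Suc j))"
proof -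
  let ?I = "{..<length p - 1}"
  have disj: "(\<lambda>j. (p ! j, p ! Suc j)) ` ?I \<inter> (\<lambda>j. (p ! Suc j, p ! j)) ` ?I = {}"
    using assms(1) by (auto simp: nth_eq_iff_index_eq)
  have inj1: "inj_on (\<lambda>j. (p ! j, p ! Suc j)) ?I" 
    using assms(1) by (auto intro!: inj_onI simp: nth_eq_iff_index_eq)
  have inj2: "inj_on (\<lambda>j. (p ! Suc j, p ! j)) ?I"
    using assms(1) by (auto intro!: inj_onI simp: nth_eq_iff_index_eq)
  have "sum g (path_arcs p) =
      (\<Sum>j\<in>?I. g (p ! j, p ! Suc j)) + (\<Sum>j\<in>?I. g (p ! Suc j, p ! j))"
    unfolding path_arcs_def using disj inj1 inj2
    by (subst sum.union_disjoint) (simp_all add: sum.reindex)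
  also have "(\<Sum>j\<in>?I. g (p ! Suc j, p ! j)) = (\<Sum>j\<in>?I. g (p ! j, p ! Suc j))"
    by (intro sum.cong refl assms(2)) auto
  finally show ?thesis by simp
qed

text \<open>Cauchy--Schwarz for the telescoping sum of differences, each split as
  \<open>b\<^sup>-\<^sup>1\<^sup>/\<^sup>2 \<cdot> b\<^sup>1\<^sup>/\<^sup>2 (f(x\<^sub>j) - f(x\<^sub>j\<^sub>+\<^sub>1))\<close>; the squares of the first factors add up to the length.\<close>

lemma square_diff_le_length_times_energy:
  assumes "graph_path X b x y p"
  shows "(f x - f y)\<^sup>2 \<le> graph_path_length b p *
    (\<Sum>j<length p - 1. b (p ! j) (p ! Suc j) * (f (p ! j) - f (p ! Suc j))\<^sup>2)"
proof -
  let ?I = "{..<length p - 1}" and ?b = "\<lambda>j. b (p ! j) (p ! Suc j)"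
    and ?d = "\<lambda>j. f (p ! j) - f (p ! Suc j)"
  have pos: "0 < ?b j" if "j \<in> ?I" for j
    using assms that by (auto simp: graph_path_def)
  have "f x - f y = (\<Sum>j\<in>?I. ?d j)"
    using assms sum_lessThan_telescope'[of "\<lambda>j. f (p ! j)" "length p - 1"]
    by (auto simp: graph_path_def hd_conv_nth last_conv_nth)
  also have "\<dots> = (\<Sum>j\<in>?I. sqrt (1 / ?b j) * (sqrt (?b j) * ?d j))"
    by (intro sum.cong refl) (use pos in \<open>force simp: real_sqrt_divide\<close>)
  finally have "(f x - f y)\<^sup>2 \<le>
      (\<Sum>j\<in>?I. (sqrt (1 / ?b j))\<^sup>2) * (\<Sum>j\<in>?I. (sqrt (?b j) * ?d j)\<^sup>2)"
    using Cauchy_Schwarz_ineq_sum[of "\<lambda>j. sqrt (1 / ?b j)" "\<lambda>j. sqrt (?b j) * ?d j" ?I]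
    by simp
  also have "(\<Sum>j\<in>?I. (sqrt (1 / ?b j))\<^sup>2) = graph_path_length b p"
    unfolding graph_path_length_def Suc_eq_plus1[symmetric]
    using pos by (intro sum.cong refl real_sqrt_pow2) (simp add: less_imp_le)
  also have "(\<Sum>j\<in>?I. (sqrt (?b j) * ?d j)\<^sup>2) = (\<Sum>j\<in>?I. ?b j * (?d j)\<^sup>2)"
    using pos by (intro sum.cong refl) (simp add: power_mult_distrib less_imp_le)
  finally show ?thesis .
qed

lemma square_diff_le_sum_path_arcs:
  assumes "graph_path X b x y p" and "distinct p"
  shows "(f x - f y)\<^sup>2 \<le> graph_path_length b p / 2 *
    (\<Sum>(u, v)\<in>path_arcs p. b u v * (f u - f v)\<^sup>2)"
proof -
  have "set p \<subseteq> X" using assms(1) by (simp add: graph_path_def)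
  then have "(\<Sum>(u, v)\<in>path_arcs p. b u v * (f u - f v)\<^sup>2) =
      2 * (\<Sum>j<length p - 1. b (p ! j) (p ! Suc j) * (f (p ! j) - f (p ! Suc j))\<^sup>2)"
    using assms(2) weight_sym by (subst sum_path_arcs) (auto simp: power2_commute subset_iff)
  then show ?thesis
    using square_diff_le_length_times_energy[OF assms(1), of f] by simp
qed

section \<open>Finite partial sums of mass and energy\<close>

lemma finite_sum_le_infsum_ennreal:
  fixes h :: "'b \<Rightarrow> ennreal"
  assumes "finite F" and "F \<subseteq> A"
  shows "sum h F \<le> infsum h A"
  using assms infsum_mono_neutral[of h F h A] by (auto simp: nonneg_summable_on_complete)

lemma sum_le_of_vol_le:
  assumes "finite F" and "F \<subseteq> A" and "A \<subseteq> X" and "vol m A \<le> ennreal V" and "0 \<le> V"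
  shows "sum m F \<le> V"
proof -
  have "ennreal (sum m F) = (\<Sum>x\<in>F. ennreal (m x))"
    using assms measure_pos by (intro sum_ennreal[symmetric]) (auto simp: subset_iff less_imp_le)
  also have "\<dots> \<le> ennreal V"
    using finite_sum_le_infsum_ennreal[OF assms(1,2)] assms(4) unfolding vol_def
    by (rule order_trans)
  finally show ?thesis using assms(5) by simp
qed

lemma sum_le_twice_energy:
  assumes "finite U" and "U \<subseteq> X \<times> X" and "energy X b f = ennreal e" and "0 \<le> e"
  shows "(\<Sum>(u, v)\<in>U. b u v * (f u - f v)\<^sup>2) \<le> 2 * e"
proof -
  let ?g = "\<lambda>(u, v). b u v * (f u - f v)\<^sup>2"
  have "ennreal (sum ?g U) = (\<Sum>(u, v)\<in>U. ennreal (b u v * (f u - f v)\<^sup>2))"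
    using assms weight_nonneg
    by (subst sum_ennreal[symmetric]) (auto intro!: sum.cong)
  also have "\<dots> \<le> (\<Sum>\<^sub>\<infinity>(u, v)\<in>X \<times> X. ennreal (b u v * (f u - f v)\<^sup>2))"
    using assms by (intro finite_sum_le_infsum_ennreal)
  also have "\<dots> = 2 * (1 / 2 * \<dots>)"
    by (simp add: mult.assoc[symmetric] ennreal_times_divide)
  also have "\<dots> = ennreal (2 * e)"
    using assms(3,4) unfolding energy_def by (simp add: ennreal_mult)
  finally show ?thesis using assms(4) by simp
qed

section \<open>The spectral estimate\<close>

lemma short_path_leaving:
  assumes "x \<in> \<Omega>" and "inradius X b \<Omega> < ennreal s"
  shows "\<exists>p y. y \<in> X - \<Omega> \<and> graph_path X b x y p \<and> distinct p \<and> graph_path_length b p < s"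
proof -
  have "0 < s" using assms(2) by (metis ennreal_less_zero_iff not_gr_zero not_less_zero)
  have "\<not> path_ball X b s x \<subseteq> \<Omega>"
  proof
    assume "path_ball X b s x \<subseteq> \<Omega>"
    then have "ennreal s \<le> inradius X b \<Omega>"
      unfolding inradius_def using assms(1) \<open>0 < s\<close> by (intro SUP_upper) auto
    then show False using assms(2) by simp
  qed
  then obtain y where y: "y \<in> X - \<Omega>" "path_dist X b x y < ennreal s"
    by (auto simp: path_ball_def)
  then obtain p where p: "graph_path X b x y p" "ennreal (graph_path_length b p) < ennreal s"
    by (auto simp: path_dist_def INF_less_iff)
  then have "graph_path_length b p < s"
    using graph_path_length_nonneg[of b p]
    by (simp add: graph_path_iff_successively ennreal_less_iff)
  then show ?thesis
    using y(1) graph_path_loop_removal[OF p(1)] by (meson order_le_less_trans)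
qed

text \<open>The Poincare inequality for a finite part of the squared norm. Taking the sum over an arbitrary
  finite \<open>F\<close> keeps every rearrangement below finite, and the bound does not depend on \<open>F\<close>.\<close>

lemma poincare_finite:
  assumes \<Omega>: "\<Omega> \<subseteq> X" and R: "inradius X b \<Omega> < ennreal s"
    and V: "\<And>u. u \<in> X \<Longrightarrow> vol m (path_ball X b s u) \<le> ennreal V" and "0 \<le> V"
    and f: "\<And>x. x \<in> X - \<Omega> \<Longrightarrow> f x = 0"
    and e: "energy X b f = ennreal e" "0 \<le> e"
    and F: "finite F" "F \<subseteq> X"
  shows "(\<Sum>x\<in>F. (f x)\<^sup>2 * m x) \<le> s * V * e"
proof -
  let ?g = "\<lambda>(u, v). b u v * (f u - f v)\<^sup>2"
  have "0 < s" using R by (metis ennreal_less_zero_iff not_gr_zero not_less_zero)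
  obtain P Y where PY: "\<And>x. x \<in> \<Omega> \<Longrightarrow> Y x \<in> X - \<Omega> \<and> graph_path X b x (Y x) (P x) \<and>
      distinct (P x) \<and> graph_path_length b (P x) < s"
    using short_path_leaving[OF _ R] by metis
  define G where "G = F \<inter> \<Omega>"
  define U where "U = (\<Union>x\<in>G. path_arcs (P x))"
  have G: "finite G" "\<And>x. x \<in> G \<Longrightarrow> x \<in> \<Omega>" "G \<subseteq> X"
    using F by (auto simp: G_def)
  have PX: "set (P x) \<subseteq> X" if "x \<in> G" for x
    using PY G(2) that by (auto simp: graph_path_def)
  have U: "finite U" "U \<subseteq> X \<times> X"
    using G(1) PX path_arcs_subset by (fastforce simp: U_def)+
  have g: "0 \<le> ?g a" if "a \<in> U" for a
    using U(2) weight_nonneg that by auto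
  have point: "(f x)\<^sup>2 \<le> s / 2 * sum ?g (path_arcs (P x))" if "x \<in> G" for x
  proof -
    have p: "Y x \<in> X - \<Omega>" "graph_path X b x (Y x) (P x)" "distinct (P x)"
        "graph_path_length b (P x) < s"
      using PY G(2) that by auto
    have "(f x)\<^sup>2 \<le> graph_path_length b (P x) / 2 * sum ?g (path_arcs (P x))"
      using square_diff_le_sum_path_arcs[OF p(2,3), of f] f[OF p(1)] by simp
    also have "\<dots> \<le> s / 2 * sum ?g (path_arcs (P x))"
      using p(4) that by (intro mult_right_mono sum_nonneg g) (auto simp: U_def)
    finally show ?thesis .
  qed
  \<comment> \<open>The weight of an arc: only paths starting near its tail can use it.\<close>
  have mass: "(\<Sum>x\<in>{x \<in> G. a \<in> path_arcs (P x)}. m x) \<le> V" if "a \<in> U" for a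
  proof -
    obtain u v where a: "a = (u, v)" "u \<in> X" using U(2) \<open>a \<in> U\<close> by (cases a) auto
    have "x \<in> path_ball X b s u" if x: "x \<in> G" "(u, v) \<in> path_arcs (P x)" for x
    proof -
      have "u \<in> set (P x)" using x(2) path_arcs_subset by blast
      then have "path_dist X b u x \<le> ennreal (graph_path_length b (P x))"
        using PY G(2) x(1) by (intro path_dist_to_start_le) auto
      also have "\<dots> < ennreal s"
        using PY G(2) x(1) \<open>0 < s\<close> by (intro ennreal_lessI) auto
      finally show ?thesis using G(3) x(1) by (auto simp: path_ball_def)
    qed
    then show ?thesis
      using G(1) V[OF a(2)] \<open>0 \<le> V\<close> a(1)
      by (intro sum_le_of_vol_le[of _ "path_ball X b s u"]) (auto simp: path_ball_def)
  qed
  have "(\<Sum>x\<in>F. (f x)\<^sup>2 * m x) = (\<Sum>x\<in>G. (f x)\<^sup>2 * m x)"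
    using F f by (intro sum.mono_neutral_right) (auto simp: G_def)
  also have "\<dots> \<le> (\<Sum>x\<in>G. s / 2 * sum ?g (path_arcs (P x)) * m x)"
    using point measure_pos G(3)
    by (intro sum_mono mult_right_mono) (auto simp: less_imp_le subset_iff)
  also have "\<dots> = s / 2 * (\<Sum>x\<in>G. \<Sum>a\<in>path_arcs (P x). ?g a * m x)"
    by (simp add: sum_distrib_left sum_distrib_right mult.assoc)
  also have "(\<Sum>x\<in>G. \<Sum>a\<in>path_arcs (P x). ?g a * m x) =
      (\<Sum>x\<in>G. \<Sum>a\<in>{a \<in> U. a \<in> path_arcs (P x)}. ?g a * m x)"
    by (intro sum.cong refl) (auto simp: U_def)
  also have "\<dots> = (\<Sum>a\<in>U. \<Sum>x\<in>{x \<in> G. a \<in> path_arcs (P x)}. ?g a * m x)"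
    using G(1) U(1) by (rule sum.swap_restrict)
  also have "\<dots> = (\<Sum>a\<in>U. ?g a * (\<Sum>x\<in>{x \<in> G. a \<in> path_arcs (P x)}. m x))"
    by (simp add: sum_distrib_left)
  also have "s / 2 * \<dots> \<le> s / 2 * (\<Sum>a\<in>U. ?g a * V)"
    using mass g \<open>0 < s\<close> by (intro mult_left_mono sum_mono) auto
  also have "\<dots> = s / 2 * V * sum ?g U"
    by (simp add: sum_distrib_right[symmetric])
  also have "\<dots> \<le> s / 2 * V * (2 * e)"
    using sum_le_twice_energy[OF U e] \<open>0 < s\<close> \<open>0 \<le> V\<close> by (intro mult_left_mono) auto
  finally show ?thesis by simp
qed

text \<open>The infimum in \<open>vol\<^sup>\<sharp>\<close> may be nearly attained only at radii far from \<open>\<rho>\<close>, but balls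
  grow with their radius, so such a radius can be replaced by a smaller one. Radius and volume bound
  are then simultaneously close to their limits.\<close>

lemma vol_sharp_approx:
  assumes "0 \<le> \<rho>"
    and "vol_sharp X b m (ennreal \<rho>) = ennreal w" "0 \<le> w" and "0 < \<epsilon>"
  obtains s where "\<rho> < s" "s \<le> \<rho> + \<epsilon>"
    "\<And>u. u \<in> X \<Longrightarrow> vol m (path_ball X b s u) \<le> ennreal (w + \<epsilon>)"
proof -
  have "vol_sharp X b m (ennreal \<rho>) < ennreal (w + \<epsilon>)"
    using assms by (simp add: ennreal_less_iff)
  then obtain t where t: "ennreal \<rho> < ennreal t"
      "(SUP x\<in>X. vol m (path_ball X b t x)) < ennreal (w + \<epsilon>)"
    by (auto simp: vol_sharp_def INF_less_iff)
  define s where "s = min t (\<rho> + \<epsilon>)"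
  have "vol m (path_ball X b s u) \<le> ennreal (w + \<epsilon>)" if "u \<in> X" for u
  proof -
    have "path_ball X b s u \<subseteq> path_ball X b t u"
      unfolding path_ball_def s_def
      by (auto elim!: order_less_le_trans intro!: ennreal_leI)
    then have "vol m (path_ball X b s u) \<le> vol m (path_ball X b t u)"
      unfolding vol_def by (intro infsum_mono_neutral) (auto simp: nonneg_summable_on_complete)
    also have "\<dots> \<le> (SUP x\<in>X. vol m (path_ball X b t x))"
      using that by (rule SUP_upper)
    finally show ?thesis using t(2) by simp
  qed
  moreover have "\<rho> < s" "s \<le> \<rho> + \<epsilon>"
    using t(1) assms by (auto simp: s_def ennreal_less_iff)
  ultimately show ?thesis using that by blast
qed

lemma energy_lower_bound:
  assumes \<Omega>: "\<Omega> \<subseteq> X" and \<rho>: "inradius X b \<Omega> = ennreal \<rho>" "0 \<le> \<rho>"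
    and w: "vol_sharp X b m (ennreal \<rho>) = ennreal w" "0 \<le> w"
    and f: "f \<in> ell2 X m" "ell2_norm X m f = 1" "\<And>x. x \<in> X - \<Omega> \<Longrightarrow> f x = 0"
    and e: "energy X b f = ennreal e" "0 \<le> e"
  shows "1 \<le> \<rho> * w * e"
proof -
  have approx: "1 \<le> (\<rho> + \<epsilon>) * (w + \<epsilon>) * e" if \<epsilon>: "0 < \<epsilon>" for \<epsilon>
  proof -
    obtain s where s: "\<rho> < s" "s \<le> \<rho> + \<epsilon>"
      "\<And>u. u \<in> X \<Longrightarrow> vol m (path_ball X b s u) \<le> ennreal (w + \<epsilon>)"
      using vol_sharp_approx[OF \<rho>(2) w \<epsilon>] by blast
    have "1 = (\<Sum>\<^sub>\<infinity>x\<in>X. (f x)\<^sup>2 * m x)"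
      using f(2) by (simp add: ell2_norm_def)
    also have "\<dots> \<le> s * (w + \<epsilon>) * e"
      using f(1) s \<epsilon> w(2) \<rho>
      by (intro infsum_le_finite_sums poincare_finite[OF \<Omega> _ _ _ f(3) e])
        (auto simp: ell2_def ennreal_less_iff)
    also have "\<dots> \<le> (\<rho> + \<epsilon>) * (w + \<epsilon>) * e"
      using s \<epsilon> w(2) e(2) by (intro mult_right_mono) auto
    finally show ?thesis .
  qed
  have "((\<lambda>\<epsilon>. (\<rho> + \<epsilon>) * (w + \<epsilon>) * e) \<longlongrightarrow> (\<rho> + 0) * (w + 0) * e) (at_right 0)"
    by (intro tendsto_intros)
  moreover have "\<forall>\<^sub>F \<epsilon> in at_right 0. 1 \<le> (\<rho> + \<epsilon>) * (w + \<epsilon>) * e"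
    using approx by (auto intro: eventually_mono[OF eventually_at_right_less])
  ultimately show ?thesis
    by (metis add.right_neutral tendsto_lowerbound trivial_limit_at_right_real)
qed

end

theorem theorem4p4:
  fixes X \<Omega> :: "'a set" and b :: "'a \<Rightarrow> 'a \<Rightarrow> real" and m :: "'a \<Rightarrow> real"
  assumes "weighted_graph X b m"
    and "connected_graph X b"
    and "\<Omega> \<subset> X"
    and "inradius X b \<Omega> < \<infinity>"
    and "vol_sharp X b m (inradius X b \<Omega>) < \<infinity>"
  shows "dirichlet_bottom X b m \<Omega> \<ge> 1 / (inradius X b \<Omega> * vol_sharp X b m (inradius X b \<Omega>))"
proof -
  interpret weighted_graph X b m by fact
  obtain \<rho> where \<rho>: "inradius X b \<Omega> = ennreal \<rho>" "0 \<le> \<rho>"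
    using assms(4) by (metis infinity_ennreal_def less_top_ennreal)
  obtain w where w: "vol_sharp X b m (ennreal \<rho>) = ennreal w" "0 \<le> w"
    using assms(5) \<rho>(1) by (metis infinity_ennreal_def less_top_ennreal)
  have "1 / (ennreal \<rho> * ennreal w) \<le> energy X b f"
    if f: "f \<in> ell2 X m" "energy X b f < \<infinity>" "\<forall>x\<in>X - \<Omega>. f x = 0" "ell2_norm X m f = 1" for f
  proof -
    obtain e where e: "energy X b f = ennreal e" "0 \<le> e"
      using f(2) by (metis infinity_ennreal_def less_top_ennreal)
    \<comment> \<open>If \<open>\<rho> w = 0\<close>, the claimed bound is infinite; this inequality then excludes any test function.\<close>
    have le: "1 \<le> \<rho> * w * e"
      using assms(3) f by (intro energy_lower_bound[OF _ \<rho> w f(1,4) _ e]) auto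
    then have pos: "0 < \<rho> * w"
      using e(2) \<rho>(2) w(2) by (metis less_le mult_nonneg_nonneg mult_zero_left not_one_le_zero)
    have "1 / (ennreal \<rho> * ennreal w) = ennreal (1 / (\<rho> * w))"
      using pos \<rho>(2) w(2) by (simp add: ennreal_mult[symmetric] divide_ennreal flip: ennreal_1)
    also have "\<dots> \<le> ennreal e"
      using le pos by (intro ennreal_leI) (simp add: field_simps)
    finally show ?thesis by (simp add: e(1))
  qed
  then show ?thesis
    unfolding dirichlet_bottom_def \<rho>(1) w(1) by (intro INF_greatest) auto
qed

end
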